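(* Let $n \ge 3$ be an integer. Then $|\Gamma_n^{n-1}| = \frac{1}{2}\cdot |PAP_n|$.
   Context: $[n]=\{0,1,\dots,n-1\}$ with its usual order. An inversion of a one-to-one partial mapping $\alpha$ on $[n]$ is a pair $a,b$ in its domain with $a<b$ and $\alpha(a)>\alpha(b)$; $\alpha$ is even if its number of inversions is even. For $2\le t\le n$, $\Gamma_n^t$ is the set of all permutations of $[n]$ whose restriction to every $t$-element subset of $[n]$ is even. A permutation $\alpha$ of $[n]$ is parity-alternating if for every $a=0,\dots,n-2$ we have $\alpha(a)\not\equiv\alpha(a+1)\pmod 2$; $PAP_n$ is the set of all parity-alternating permutations of $[n]$. *)

theory Defs
  imports Complex_Main "HOL-Combinatorics.Permutations"
begin

definition inversions :: "(nat \<rightharpoonup> nat) \<Rightarrow> (nat \<times> nat) set" where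
  "inversions f = {(a, b). a \<in> dom f \<and> b \<in> dom f \<and> a < b \<and> the (f a) > the (f b)}"

(* Meant for injective maps with finite domain. *)
definition even_partial_map :: "(nat \<rightharpoonup> nat) \<Rightarrow> bool" where
  "even_partial_map f \<longleftrightarrow> even (card (inversions f))"

(* A permutation of {0, ..., n - 1} is a total function that permutes {..<n} and hence is the
   identity elsewhere, so each permutation is represented exactly once. Its restriction to A is
   the partial map (Some \<circ> p) |` A with domain A. The intended range is 2 \<le> t \<le> n. *)
definition Gamma_perms :: "nat \<Rightarrow> nat \<Rightarrow> (nat \<Rightarrow> nat) set" where
  "Gamma_perms n t =
    {p. p permutes {..<n} \<and>
        (\<forall>A. A \<subseteq> {..<n} \<and> card A = t \<longrightarrow> even_partial_map ((Some \<circ> p) |` A))}"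

definition PAP :: "nat \<Rightarrow> (nat \<Rightarrow> nat) set" where
  "PAP n =
    {p. p permutes {..<n} \<and> (\<forall>a. a + 1 < n \<longrightarrow> p a mod 2 \<noteq> p (a + 1) mod 2)}"

end

theory Submission
  imports Defs
begin

text \<open>Restricting a permutation \<open>p\<close> of \<open>[n]\<close> to \<open>[n] - {c}\<close> destroys exactly the inversions that
  involve \<open>c\<close>, and the number of these has the parity of \<open>p c + c\<close> (\<open>even_inversions_at\<close>). So
  \<open>p\<close> lies in \<open>\<Gamma>\<close> for \<open>t = n - 1\<close> if and only if every \<open>p c + c\<close> has the parity of the number of
  inversions of \<open>p\<close>. Now \<open>p\<close> is parity-alternating if and only if the parity of
  \<open>p c + c\<close> does not depend on \<open>c\<close>, that is, if it is always that of \<open>p 0\<close>. Hence \<open>\<Gamma>\<close> consists of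
  those parity-alternating \<open>p\<close> whose number of inversions has the parity of \<open>p 0\<close>
  (\<open>Gamma_perms_eq_PAP_subset\<close>).

  This condition selects exactly half of the parity-alternating permutations: exchanging the
  entries at positions \<open>0\<close> and \<open>2\<close>, which have equal parity, preserves both parity alternation
  and the parity of the entry at \<open>0\<close>, but changes the parity of the number of inversions,
  because it is a product of three adjacent transpositions.\<close>

definition inversions_on :: "nat set \<Rightarrow> (nat \<Rightarrow> nat) \<Rightarrow> (nat \<times> nat) set" where
  "inversions_on A p = {(a, b). a \<in> A \<and> b \<in> A \<and> a < b \<and> p b < p a}"

lemma inversions_restrict: "inversions ((Some \<circ> p) |` A) = inversions_on A p"
  by (auto simp: inversions_def inversions_on_def dom_def restrict_map_def split: if_splits)

lemma finite_inversions_on: "finite A \<Longrightarrow> finite (inversions_on A p)"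
  by (rule finite_subset[of _ "A \<times> A"]) (auto simp: inversions_on_def)

text \<open>Let \<open>D\<close> be the set of positions before \<open>c\<close> with a smaller entry. The other positions before
  \<open>c\<close> form inversions with \<open>c\<close>, and there are \<open>c - |D|\<close> of them. The entries smaller than \<open>p c\<close>
  that are not taken on \<open>D\<close> stand after \<open>c\<close>, and there are \<open>p c - |D|\<close> of them. So \<open>c\<close> is involved
  in \<open>c + p c - 2 |D|\<close> inversions.\<close>

lemma even_inversions_at:
  assumes p: "p permutes {..<n}" and c: "c < n"
  shows "even (card (inversions_on ({..<n} - {c}) p)) \<longleftrightarrow>
    (even (card (inversions_on {..<n} p)) \<longleftrightarrow> even (p c + c))"
proof -
  define U where "U = {a. a < c \<and> p c < p a}"
  define D where "D = {a. a < c \<and> p a < p c}"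
  define V where "V = {b. c < b \<and> b < n \<and> p b < p c}"
  have inj: "inj p" using p by (rule permutes_inj)
  have fin: "finite U" "finite D" "finite V"
    by (auto simp: U_def D_def V_def)
  have "p a \<noteq> p c" if "a < c" for a
    using injD[OF inj, of a c] that by auto
  then have "{..<c} = U \<union> D"
    by (auto simp: U_def D_def neq_iff)
  moreover have "U \<inter> D = {}" by (auto simp: U_def D_def)
  ultimately have UD: "card U + card D = c"
    using card_Un_disjoint[of U D] fin by (metis card_lessThan)
  have "p ` (D \<union> V) = {..<p c}"
  proof (intro equalityI subsetI)
    fix y assume y: "y \<in> {..<p c}"
    have pc: "p c < n" using permutes_in_image[OF p, of c] c by simp
    obtain x where x: "y = p x" using permutes_surj[OF p] by (metis surjD)
    have "x < n" using permutes_in_image[OF p, of x] x y pc by simp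
    moreover have "x \<noteq> c" using x y by auto
    ultimately show "y \<in> p ` (D \<union> V)"
      using x y by (auto simp: D_def V_def)
  qed (auto simp: D_def V_def)
  then have "card (D \<union> V) = p c"
    using card_image[OF inj_on_subset[OF inj], of "D \<union> V"] by simp
  moreover have "D \<inter> V = {}" by (auto simp: V_def D_def)
  ultimately have DV: "card D + card V = p c"
    using card_Un_disjoint[of D V] fin by simp
  have split: "inversions_on {..<n} p =
      inversions_on ({..<n} - {c}) p \<union> ((\<lambda>a. (a, c)) ` U \<union> Pair c ` V)"
    using c by (auto simp: inversions_on_def U_def V_def)
  have "card (inversions_on {..<n} p) =
      card (inversions_on ({..<n} - {c}) p) + card ((\<lambda>a. (a, c)) ` U \<union> Pair c ` V)"
    unfolding split
    by (intro card_Un_disjoint finite_inversions_on) (use fin in \<open>auto simp: inversions_on_def\<close>)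
  also have "card ((\<lambda>a. (a, c)) ` U \<union> Pair c ` V) = card ((\<lambda>a. (a, c)) ` U) + card (Pair c ` V)"
    by (rule card_Un_disjoint) (use fin in \<open>auto simp: U_def\<close>)
  also have "\<dots> = card U + card V"
    by (simp add: card_image inj_on_def)
  finally have "card (inversions_on {..<n} p) + 2 * card D =
      card (inversions_on ({..<n} - {c}) p) + (p c + c)"
    using UD DV by simp
  then show ?thesis by (metis even_add dvd_triv_left)
qed

lemma Gamma_perms_iff:
  assumes "n \<ge> 1"
  shows "p \<in> Gamma_perms n (n - 1) \<longleftrightarrow> p permutes {..<n} \<and>
    (\<forall>c<n. even (card (inversions_on {..<n} p)) \<longleftrightarrow> even (p c + c))"
proof -
  have subsets: "A \<subseteq> {..<n} \<and> card A = n - 1 \<longleftrightarrow> (\<exists>c<n. A = {..<n} - {c})" for A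
  proof
    assume A: "A \<subseteq> {..<n} \<and> card A = n - 1"
    then have "card ({..<n} - A) = 1"
      using assms by (subst card_Diff_subset) (auto intro: finite_subset)
    then obtain c where "{..<n} - A = {c}" by (rule card_1_singletonE)
    then have "c < n \<and> A = {..<n} - {c}" using A by blast
    then show "\<exists>c<n. A = {..<n} - {c}" by blast
  qed auto
  have "p \<in> Gamma_perms n (n - 1) \<longleftrightarrow> p permutes {..<n} \<and>
      (\<forall>c<n. even (card (inversions_on ({..<n} - {c}) p)))"
    unfolding Gamma_perms_def even_partial_map_def inversions_restrict subsets mem_Collect_eq
    by metis
  then show ?thesis using even_inversions_at[of p n] by blast
qed

lemma PAP_iff:
  "p \<in> PAP n \<longleftrightarrow> p permutes {..<n} \<and> (\<forall>c<n. even (p c + c) \<longleftrightarrow> even (p 0))"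
proof -
  have alt: "p a mod 2 \<noteq> p (a + 1) mod 2 \<longleftrightarrow> (even (p (a + 1) + (a + 1)) \<longleftrightarrow> even (p a + a))" for a
    by (auto simp: mod2_eq_if)
  have "even (p c + c) \<longleftrightarrow> even (p 0)"
    if "\<forall>a. a + 1 < n \<longrightarrow> p a mod 2 \<noteq> p (a + 1) mod 2" "c < n" for c
    using that(2)
  proof (induction c)
    case (Suc c)
    then show ?case using that(1) alt[of c] by simp
  qed simp
  moreover have "p a mod 2 \<noteq> p (a + 1) mod 2"
    if "\<forall>c<n. even (p c + c) \<longleftrightarrow> even (p 0)" "a + 1 < n" for a
    using that(1)[rule_format, of a] that(1)[rule_format, of "a + 1"] that(2) alt[of a]
    by linarith
  ultimately show ?thesis by (auto simp: PAP_def)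
qed

lemma Gamma_perms_eq_PAP_subset:
  assumes "n \<ge> 1"
  shows "Gamma_perms n (n - 1) =
    {p \<in> PAP n. even (card (inversions_on {..<n} p)) \<longleftrightarrow> even (p 0)}"
proof -
  have "(\<forall>c<n. P \<longleftrightarrow> even (p c + c)) \<longleftrightarrow> (\<forall>c<n. even (p c + c) \<longleftrightarrow> even (p 0)) \<and> (P \<longleftrightarrow> even (p 0))"
    for P and p :: "nat \<Rightarrow> nat"
  proof -
    have "0 < n" "even (p 0 + 0) \<longleftrightarrow> even (p 0)" using assms by simp_all
    then show ?thesis by blast
  qed
  then show ?thesis
    unfolding set_eq_iff mem_Collect_eq Gamma_perms_iff[OF assms] PAP_iff by blast
qed

text \<open>Exchanging the entries at \<open>i\<close> and \<open>Suc i\<close> creates or destroys the inversion at these two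
  positions. Every other inversion is carried along by the transposition, which preserves the
  order of every other pair of positions.\<close>

lemma even_inversions_adjacent_transpose:
  assumes inj: "inj p" and i: "Suc i < n"
  shows "even (card (inversions_on {..<n} (p \<circ> transpose i (Suc i)))) \<longleftrightarrow>
    odd (card (inversions_on {..<n} p))"
proof -
  define t where "t = transpose i (Suc i)"
  define R where "R q = inversions_on {..<n} q - {(i, Suc i)}" for q
  have t: "t x = (if x = i then Suc i else if x = Suc i then i else x)" for x
    by (simp add: t_def transpose_def)
  have tt: "t (t x) = x" for x by (simp add: t_def)
  have sub: "map_prod t t ` R q \<subseteq> R (q \<circ> t)" for q
  proof
    fix z assume "z \<in> map_prod t t ` R q"
    then obtain a b where z: "z = (t a, t b)" and ab: "a < b" "b < n" "q b < q a"
      "(a, b) \<noteq> (i, Suc i)"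
      by (auto simp: R_def inversions_on_def)
    have "t a < t b \<and> (t a, t b) \<noteq> (i, Suc i)" using ab unfolding t by auto
    moreover have "t a < n" "t b < n" using ab i unfolding t by auto
    ultimately show "z \<in> R (q \<circ> t)" using ab by (simp add: z R_def inversions_on_def tt)
  qed
  \<comment> \<open>Since \<open>t\<close> is an involution, the inclusion for \<open>p \<circ> t\<close> gives the converse one for \<open>p\<close>.\<close>
  have "p \<circ> t \<circ> t = p" by (simp add: fun_eq_iff tt)
  then have "map_prod t t ` R (p \<circ> t) \<subseteq> R p" using sub[of "p \<circ> t"] by simp
  then have "map_prod t t ` map_prod t t ` R (p \<circ> t) \<subseteq> map_prod t t ` R p" by blast
  then have "R (p \<circ> t) \<subseteq> map_prod t t ` R p"
    by (simp add: image_comp comp_def map_prod_def case_prod_unfold tt)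
  then have "R (p \<circ> t) = map_prod t t ` R p" using sub by blast
  moreover have "inj_on (map_prod t t) (R p)"
    by (rule inj_on_inverseI[where g = "map_prod t t"]) (auto simp: tt)
  ultimately have R: "card (R (p \<circ> t)) = card (R p)" by (simp add: card_image)
  have card: "card (inversions_on {..<n} q) = card (R q) + (if q (Suc i) < q i then 1 else 0)" for q
  proof (cases "q (Suc i) < q i")
    case True
    then have "(i, Suc i) \<in> inversions_on {..<n} q" using i by (simp add: inversions_on_def)
    then show ?thesis
      using True card.remove[OF finite_inversions_on[of "{..<n}" q]] by (simp add: R_def)
  next
    case False
    then have "R q = inversions_on {..<n} q" by (auto simp: R_def inversions_on_def)
    then show ?thesis using False by simp
  qed
  have "p i \<noteq> p (Suc i)" using injD[OF inj] by fastforce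
  then show ?thesis
    using card[of p] card[of "p \<circ> t"] R by (auto simp: t simp flip: t_def)
qed

lemma even_inversions_transpose_0_2:
  assumes inj: "inj p" and n: "n \<ge> 3"
  shows "even (card (inversions_on {..<n} (p \<circ> transpose 0 2))) \<longleftrightarrow>
    odd (card (inversions_on {..<n} p))"
proof -
  have eq: "p \<circ> transpose 0 2 =
      p \<circ> transpose 0 (Suc 0) \<circ> transpose (Suc 0) (Suc (Suc 0)) \<circ> transpose 0 (Suc 0)"
    by (auto simp: fun_eq_iff transpose_def numeral_2_eq_2)
  have *: "inj (p \<circ> transpose 0 (Suc 0))"
    "inj (p \<circ> transpose 0 (Suc 0) \<circ> transpose (Suc 0) (Suc (Suc 0)))"
    using inj by (auto intro!: inj_compose)
  show ?thesis
    unfolding eq using n inj * by (simp add: even_inversions_adjacent_transpose del: o_apply)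
qed

theorem theorem9:
  fixes n :: nat
  assumes "n \<ge> 3"
  shows "real (card (Gamma_perms n (n - 1))) = 1 / 2 * real (card (PAP n))"
proof -
  define s where "s p = p \<circ> transpose 0 (2 :: nat)" for p :: "nat \<Rightarrow> nat"
  define G where "G = {p \<in> PAP n. even (card (inversions_on {..<n} p)) \<longleftrightarrow> even (p 0)}"
  have ss: "s (s p) = p" for p by (simp add: s_def fun_eq_iff)
  have par: "even (s p c) \<longleftrightarrow> even (p c)" if "p \<in> PAP n" for p c
  proof -
    have "even (p 2) \<longleftrightarrow> even (p 0)" using that assms by (auto simp: PAP_iff dest: spec[of _ 2])
    then show ?thesis by (auto simp: s_def transpose_def)
  qed
  have sPAP: "s p \<in> PAP n" if p: "p \<in> PAP n" for p
  proof -
    have "transpose 0 2 permutes {..<n}" using assms by (intro permutes_swap_id) auto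
    then have "s p permutes {..<n}"
      using p unfolding s_def by (auto simp: PAP_iff intro: permutes_compose)
    then show ?thesis using p par[OF p] by (simp add: PAP_iff)
  qed
  have flip: "s p \<in> G \<longleftrightarrow> p \<notin> G" if p: "p \<in> PAP n" for p
  proof -
    have "inj p" using p by (auto simp: PAP_iff dest: permutes_inj)
    from even_inversions_transpose_0_2[OF this assms]
    have "even (card (inversions_on {..<n} (s p))) \<longleftrightarrow> odd (card (inversions_on {..<n} p))"
      by (simp add: s_def)
    then show ?thesis using p sPAP[OF p] par[OF p] by (auto simp: G_def)
  qed
  have GP: "G \<subseteq> PAP n" by (auto simp: G_def)
  have "bij_betw s G (PAP n - G)"
    by (rule bij_betw_byWitness[where f' = s]) (use GP ss sPAP flip in auto)
  then have "card G = card (PAP n - G)" by (rule bij_betw_same_card)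
  moreover have fin: "finite (PAP n)"
    by (rule finite_subset[OF _ finite_permutations[of "{..<n}"]]) (auto simp: PAP_def)
  ultimately have "card (PAP n) = 2 * card G"
    using card_Diff_subset[OF finite_subset[OF GP fin] GP] card_mono[OF fin GP] by simp
  moreover have "Gamma_perms n (n - 1) = G"
    unfolding G_def using assms by (intro Gamma_perms_eq_PAP_subset) simp
  ultimately show ?thesis by simp
qed

end
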